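(* Let $R:C[0,1]\to C[0,1]$ be either a Bernstein-Euler-Jacobi operator of type I, $R=R^{(r,a,b)}_{m,n}=B_m\circ\mathcal{B}^{a,b}_r\circ B_n$ with $r>0$, real $a,b\ge-1$ and integers $n,m>1$, or a Bernstein-Euler-Jacobi operator of type II, $R=R^{(s,c,d;r,a,b)}_{n}=\mathcal{B}^{c,d}_s\circ B_n\circ\mathcal{B}^{a,b}_r$ with $r,s>0$, real $a,b,c,d\ge-1$ and an integer $n>1$. Assume that $R$ does not reproduce linear functions (i.e. $Re_1\neq e_1$). Put $T(f,g;x):=R(fg;x)-R(f;x)\,R(g;x)$. Then for all $f,g\in C[0,1]$ and every fixed $x\in[0,1]$, $$|T(f,g;x)|\le\frac14\,\widetilde\omega\left(f;2\sqrt{T(e_1,e_1;x)}\right)\cdot\widetilde\omega\left(g;2\sqrt{T(e_1,e_1;x)}\right),$$ where $$T(e_1,e_1;x)=R((e_1-xe_0)^2;x)-\left[R(e_1-xe_0;x)\right]^2.$$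
   Context: All functions are real-valued. For an operator $H:C[0,1]\to C[0,1]$ write $H(f;x):=(Hf)(x)$. Let $e_i(t)=t^i$ for $i\ge 0$; thus $H((e_1-xe_0)^k;x)$ denotes $H$ applied to the function $t\mapsto (t-x)^k$ (with $x$ fixed) and evaluated at the point $x$. Bernstein operator: for an integer $n\ge1$, $B_n(f;x)=\sum_{k=0}^n f(k/n)\binom{n}{k}x^k(1-x)^{n-k}$. Euler-Jacobi Beta operator: for $r>0$, $a,b\ge-1$, $f\in C[0,1]$ and $x\in[0,1]$, $$\mathcal{B}^{a,b}_r(f;x)=\frac{\int_0^1 t^{rx+a}(1-t)^{r(1-x)+b}f(t)\,dt}{\int_0^1 t^{rx+a}(1-t)^{r(1-x)+b}\,dt},$$ except that if $a=-1$ then $\mathcal{B}^{a,b}_r(f;0):=f(0)$, and if $b=-1$ then $\mathcal{B}^{a,b}_r(f;1):=f(1)$. The operator $\mathcal{B}^{c,d}_s$ is defined by the same formula with $(r,a,b)$ replaced by $(s,c,d)$. Composition is read right to left, e.g. $(B_m\circ\mathcal{B}^{a,b}_r\circ B_n)f=B_m(\mathcal{B}^{a,b}_r(B_nf))$. Modulus of continuity: $\omega(f;t)=\sup\{|f(u)-f(v)|: u,v\in[0,1],\ |u-v|\le t\}$ for $t\ge0$. Its least concave majorant $\widetilde\omega(f;\cdot)$ is the smallest concave function on $[0,\infty)$ that is $\ge\omega(f;\cdot)$; equivalently $\widetilde\omega(f;t)=\sup_{0\le u\le t\le v\le 1,\,u\ne v}\frac{(t-u)\omega(f;v)+(v-t)\omega(f;u)}{v-u}$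 for $0\le t\le1$ and $\widetilde\omega(f;t)=\omega(f;1)$ for $t>1$. *)

theory Defs
  imports "HOL-Analysis.Analysis"
begin

text \<open>
  An element of \<open>C[0,1]\<close> is represented by a function \<open>f :: real \<Rightarrow> real\<close> with
  \<open>continuous_on {0..1} f\<close>; an operator on \<open>C[0,1]\<close> by a map
  \<open>H :: (real \<Rightarrow> real) \<Rightarrow> real \<Rightarrow> real\<close>, where \<open>H f x\<close> is meaningful for \<open>x \<in> {0..1}\<close> and
  depends only on the restriction of \<open>f\<close> to \<open>{0..1}\<close>.
\<close>

definition e :: "nat \<Rightarrow> real \<Rightarrow> real" where
  "e i = (\<lambda>t. t ^ i)"

definition bernstein_op :: "nat \<Rightarrow> (real \<Rightarrow> real) \<Rightarrow> real \<Rightarrow> real" where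
  "bernstein_op n f x = (\<Sum>k\<le>n. f (real k / real n) * Bernstein n k x)"

definition beta_weight :: "real \<Rightarrow> real \<Rightarrow> real \<Rightarrow> real \<Rightarrow> real \<Rightarrow> real" where
  "beta_weight r a b x t = t powr (r * x + a) * (1 - t) powr (r * (1 - x) + b)"

text \<open>
  As \<open>0 powr p = 0\<close> for every \<open>p\<close>, the weight vanishes at the endpoints \<open>t = 0\<close> and \<open>t = 1\<close>;
  this does not affect the integrals.
\<close>

definition beta_op :: "real \<Rightarrow> real \<Rightarrow> real \<Rightarrow> (real \<Rightarrow> real) \<Rightarrow> real \<Rightarrow> real" where
  "beta_op r a b f x =
     (if a = -1 \<and> x = 0 then f 0
      else if b = -1 \<and> x = 1 then f 1
      else integral {0..1} (\<lambda>t. beta_weight r a b x t * f t) / integral {0..1} (beta_weight r a b x))"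

definition BEJ_I ::
  "real \<Rightarrow> real \<Rightarrow> real \<Rightarrow> nat \<Rightarrow> nat \<Rightarrow> (real \<Rightarrow> real) \<Rightarrow> real \<Rightarrow> real" where
  "BEJ_I r a b m n = bernstein_op m \<circ> beta_op r a b \<circ> bernstein_op n"

definition BEJ_II ::
  "real \<Rightarrow> real \<Rightarrow> real \<Rightarrow> real \<Rightarrow> real \<Rightarrow> real \<Rightarrow> nat \<Rightarrow> (real \<Rightarrow> real) \<Rightarrow> real \<Rightarrow> real" where
  "BEJ_II s c d r a b n = beta_op s c d \<circ> bernstein_op n \<circ> beta_op r a b"

definition is_BEJ_I :: "((real \<Rightarrow> real) \<Rightarrow> real \<Rightarrow> real) \<Rightarrow> bool" where
  "is_BEJ_I R \<longleftrightarrow>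
     (\<exists>r a b m n. r > 0 \<and> a \<ge> -1 \<and> b \<ge> -1 \<and> m > 1 \<and> n > 1 \<and> R = BEJ_I r a b m n)"

definition is_BEJ_II :: "((real \<Rightarrow> real) \<Rightarrow> real \<Rightarrow> real) \<Rightarrow> bool" where
  "is_BEJ_II R \<longleftrightarrow>
     (\<exists>s c d r a b n. s > 0 \<and> c \<ge> -1 \<and> d \<ge> -1 \<and> r > 0 \<and> a \<ge> -1 \<and> b \<ge> -1 \<and> n > 1
        \<and> R = BEJ_II s c d r a b n)"

definition chebyshev_functional ::
  "((real \<Rightarrow> real) \<Rightarrow> real \<Rightarrow> real) \<Rightarrow> (real \<Rightarrow> real) \<Rightarrow> (real \<Rightarrow> real) \<Rightarrow> real \<Rightarrow> real" where
  "chebyshev_functional R f g x = R (\<lambda>t. f t * g t) x - R f x * R g x"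

definition modulus :: "(real \<Rightarrow> real) \<Rightarrow> real \<Rightarrow> real" where
  "modulus f t = Sup {\<bar>f u - f v\<bar> | u v. u \<in> {0..1} \<and> v \<in> {0..1} \<and> \<bar>u - v\<bar> \<le> t}"

definition concave_majorant :: "(real \<Rightarrow> real) \<Rightarrow> (real \<Rightarrow> real) \<Rightarrow> bool" where
  "concave_majorant w h \<longleftrightarrow> concave_on {0..} h \<and> (\<forall>t\<ge>0. w t \<le> h t)"

text \<open>
  The smallest concave majorant on \<open>[0,\<infinity>)\<close> is taken as the pointwise infimum of all concave
  majorants. The lemmas \<open>modulus_tilde_concave_majorant\<close> and \<open>modulus_tilde_least\<close> below show
  that, for continuous \<open>f\<close>, it is itself a concave majorant and hence the smallest one.
\<close>

definition modulus_tilde :: "(real \<Rightarrow> real) \<Rightarrow> real \<Rightarrow> real" where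
  "modulus_tilde f t = Inf {h t | h. concave_majorant (modulus f) h}"

lemma modulus_bounded:
  assumes "continuous_on {0..1} f"
  obtains M where "\<And>t. t \<ge> 0 \<Longrightarrow> modulus f t \<le> M"
proof -
  have "compact (f ` {0..1})"
    using assms by (intro compact_continuous_image) auto
  then obtain B where B: "\<And>x. x \<in> {0..1} \<Longrightarrow> \<bar>f x\<bar> \<le> B"
    by (metis compact_imp_bounded bounded_iff imageI real_norm_def)
  have "modulus f t \<le> 2 * B" if "t \<ge> 0" for t
    unfolding modulus_def
  proof (rule cSup_least)
    have "\<bar>f 0 - f 0\<bar> \<in> {\<bar>f u - f v\<bar> | u v. u \<in> {0..1} \<and> v \<in> {0..1} \<and> \<bar>u - v\<bar> \<le> t}"
      using that by (intro CollectI exI[of _ 0]) auto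
    then show "{\<bar>f u - f v\<bar> | u v. u \<in> {0..1} \<and> v \<in> {0..1} \<and> \<bar>u - v\<bar> \<le> t} \<noteq> {}"
      by blast
  next
    fix y assume "y \<in> {\<bar>f u - f v\<bar> | u v. u \<in> {0..1} \<and> v \<in> {0..1} \<and> \<bar>u - v\<bar> \<le> t}"
    then obtain u v where "u \<in> {0..1}" "v \<in> {0..1}" "y = \<bar>f u - f v\<bar>" by blast
    then show "y \<le> 2 * B" using B[of u] B[of v] by linarith
  qed
  then show thesis using that by blast
qed

lemma modulus_tilde_least:
  assumes "concave_majorant (modulus f) h" "t \<ge> 0"
  shows "modulus_tilde f t \<le> h t"
  unfolding modulus_tilde_def
proof (rule cInf_lower)
  show "bdd_below {h t | h. concave_majorant (modulus f) h}"
    using assms(2) by (intro bdd_belowI[of _ "modulus f t"]) (auto simp: concave_majorant_def)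
qed (use assms(1) in blast)

lemma modulus_tilde_greatest:
  assumes "continuous_on {0..1} f"
    and "\<And>h. concave_majorant (modulus f) h \<Longrightarrow> c \<le> h t"
  shows "c \<le> modulus_tilde f t"
  unfolding modulus_tilde_def
proof (rule cInf_greatest)
  obtain M where "\<And>t. t \<ge> 0 \<Longrightarrow> modulus f t \<le> M"
    using modulus_bounded[OF assms(1)] by blast
  then have "concave_majorant (modulus f) (\<lambda>_. M)"
    by (auto simp: concave_majorant_def concave_on_iff simp flip: distrib_right)
  then show "{h t | h. concave_majorant (modulus f) h} \<noteq> {}" by blast
qed (use assms(2) in blast)

lemma modulus_tilde_concave_majorant:
  assumes "continuous_on {0..1} f"
  shows "concave_majorant (modulus f) (modulus_tilde f)"
  unfolding concave_majorant_def
proof (intro conjI allI impI)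
  show "concave_on {0..} (modulus_tilde f)"
    unfolding concave_on_iff
  proof (intro conjI ballI allI impI)
    fix x y u v :: real
    assume *: "x \<in> {0..}" "y \<in> {0..}" "0 \<le> u" "0 \<le> v" "u + v = 1"
    show "u * modulus_tilde f x + v * modulus_tilde f y \<le> modulus_tilde f (u *\<^sub>R x + v *\<^sub>R y)"
    proof (rule modulus_tilde_greatest[OF assms])
      fix h assume h: "concave_majorant (modulus f) h"
      have "u * modulus_tilde f x + v * modulus_tilde f y \<le> u * h x + v * h y"
        using modulus_tilde_least[OF h] * by (intro add_mono mult_left_mono) auto
      also have "\<dots> \<le> h (u *\<^sub>R x + v *\<^sub>R y)"
        using h * by (auto simp: concave_majorant_def concave_on_iff)
      finally show "u * modulus_tilde f x + v * modulus_tilde f y \<le> h (u *\<^sub>R x + v *\<^sub>R y)" .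
    qed
  qed auto
next
  fix t :: real assume "t \<ge> 0"
  then show "modulus f t \<le> modulus_tilde f t"
    by (intro modulus_tilde_greatest[OF assms]) (auto simp: concave_majorant_def)
qed

end

theory Submission
  imports Defs
begin

text \<open>
  Both types of Bernstein-Euler-Jacobi operator are built from averages, so for fixed \<open>x\<close> the map
  \<open>f \<mapsto> R(f;x)\<close> is a positive linear functional \<open>A\<close> on \<open>C[0,1]\<close> with \<open>A 1 = 1\<close>, that is, an
  expectation. The Chebyshev functional \<open>T(f,g;x)\<close> is the covariance of \<open>f\<close> and \<open>g\<close> under \<open>A\<close>, and
  \<open>\<sigma>\<^sup>2 = T(e\<^sub>1,e\<^sub>1;x)\<close> is the variance of the identity. The covariance is a positive semidefinite
  bilinear form, so by Cauchy-Schwarz it is enough to bound one standard deviation: the standard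
  deviation of \<open>f\<close> is at most half the least concave majorant of the modulus of \<open>f\<close> at \<open>2\<sigma>\<close>
  (\<open>sqrt_cov_le_modulus_tilde\<close>).

  For this, take the tangent \<open>a + L s\<close> of the concave majorant at \<open>s = 2\<sigma>\<close>. It lies above the
  modulus, so \<open>\<bar>f u - f v\<bar> \<le> a + L \<bar>u - v\<bar>\<close>. By an infimal convolution such an \<open>f\<close> lies within
  \<open>a/2\<close> of an \<open>L\<close>-Lipschitz function \<open>h\<close> (\<open>lipschitz_approximation\<close>). The standard deviation is a
  seminorm, it is at most \<open>a/2\<close> on \<open>f - h\<close> and at most \<open>L \<sigma>\<close> on \<open>h\<close>, and
  \<open>a/2 + L \<sigma>\<close> is half the value of the tangent at its point of contact. When \<open>\<sigma> = 0\<close> the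
  majorant may have no tangent of finite slope at \<open>0\<close>; then uniform continuity supplies affine
  bounds with arbitrarily small \<open>a\<close>, and the standard deviation of \<open>f\<close> vanishes.
\<close>

section \<open>Unital positive functionals on C[0,1]\<close>

locale unital_positive_functional =
  fixes A :: "(real \<Rightarrow> real) \<Rightarrow> real"
  assumes add: "\<lbrakk>continuous_on {0..1} f; continuous_on {0..1} g\<rbrakk>
                 \<Longrightarrow> A (\<lambda>t. f t + g t) = A f + A g"
    and scale: "continuous_on {0..1} f \<Longrightarrow> A (\<lambda>t. c * f t) = c * A f"
    and nonneg: "\<lbrakk>continuous_on {0..1} f; \<And>t. t \<in> {0..1} \<Longrightarrow> 0 \<le> f t\<rbrakk> \<Longrightarrow> 0 \<le> A f"
    and unital: "A (\<lambda>_. 1) = 1"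
begin

lemma const: "A (\<lambda>_. c) = c"
  using scale[of "\<lambda>_. 1" c] unital by simp

lemma diff:
  assumes "continuous_on {0..1} f" "continuous_on {0..1} g"
  shows "A (\<lambda>t. f t - g t) = A f - A g"
  using add[OF assms(1), of "\<lambda>t. - 1 * g t"] scale[OF assms(2), of "- 1"] assms(2)
  by (simp add: continuous_on_minus)

lemma mono:
  assumes "continuous_on {0..1} f" "continuous_on {0..1} g"
    and "\<And>t. t \<in> {0..1} \<Longrightarrow> f t \<le> g t"
  shows "A f \<le> A g"
  using nonneg[of "\<lambda>t. g t - f t"] diff[OF assms(2,1)] assms
  by (simp add: continuous_on_diff)

text \<open>
  Positivity forces \<open>A f\<close> to depend on \<open>f\<close> only through its values on \<open>[0,1]\<close>, which is what makes it
  a functional on \<open>C[0,1]\<close>.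
\<close>

lemma cong:
  assumes "continuous_on {0..1} f" "continuous_on {0..1} g"
    and "\<And>t. t \<in> {0..1} \<Longrightarrow> f t = g t"
  shows "A f = A g"
  using mono[OF assms(1,2)] mono[OF assms(2,1)] assms(3) by force

definition cov :: "(real \<Rightarrow> real) \<Rightarrow> (real \<Rightarrow> real) \<Rightarrow> real" where
  "cov f g = A (\<lambda>t. f t * g t) - A f * A g"

lemma cov_commute: "cov f g = cov g f"
  by (simp add: cov_def mult.commute)

lemma cov_add_left:
  assumes "continuous_on {0..1} f" "continuous_on {0..1} g" "continuous_on {0..1} h"
  shows "cov (\<lambda>t. f t + g t) h = cov f h + cov g h"
  using add[OF assms(1,2)] add[of "\<lambda>t. f t * h t" "\<lambda>t. g t * h t"] assms
  by (simp add: cov_def algebra_simps continuous_on_mult)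

lemma cov_scale_left:
  assumes "continuous_on {0..1} f" "continuous_on {0..1} g"
  shows "cov (\<lambda>t. c * f t) g = c * cov f g"
  using scale[OF assms(1), of c] scale[of "\<lambda>t. f t * g t" c] assms
  by (simp add: cov_def algebra_simps continuous_on_mult)

text \<open>
  The variance decomposition of a second moment about \<open>c\<close>: it gives nonnegativity of the variance
  (\<open>c = A f\<close>), upper bounds for it (any \<open>c\<close>), and its expression through central moments.
\<close>

lemma second_moment_shift:
  assumes f: "continuous_on {0..1} f"
  shows "A (\<lambda>t. (f t - c)\<^sup>2) = cov f f + (A f - c)\<^sup>2"
proof -
  have "A (\<lambda>t. (f t - c)\<^sup>2) = A (\<lambda>t. f t * f t + ((- 2 * c) * f t + c\<^sup>2))"
    by (simp add: power2_eq_square algebra_simps)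
  also have "\<dots> = A (\<lambda>t. f t * f t) + A (\<lambda>t. (- 2 * c) * f t + c\<^sup>2)"
    using f by (intro add continuous_intros)
  also have "A (\<lambda>t. (- 2 * c) * f t + c\<^sup>2) = A (\<lambda>t. (- 2 * c) * f t) + A (\<lambda>_. c\<^sup>2)"
    using f by (intro add continuous_intros)
  also have "\<dots> = (- 2 * c) * A f + c\<^sup>2"
    by (simp only: scale[OF f] const)
  finally show ?thesis by (simp add: cov_def power2_eq_square algebra_simps)
qed

lemma cov_self_le: "continuous_on {0..1} f \<Longrightarrow> cov f f \<le> A (\<lambda>t. (f t - c)\<^sup>2)"
  by (simp add: second_moment_shift)

lemma cov_self_nonneg:
  assumes "continuous_on {0..1} f"
  shows "0 \<le> cov f f"
  using nonneg[of "\<lambda>t. (f t - A f)\<^sup>2"] second_moment_shift[OF assms, of "A f"] assms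
  by (simp add: continuous_intros)

lemma cov_self_add_scale:
  assumes f: "continuous_on {0..1} f" and g: "continuous_on {0..1} g"
  shows "cov (\<lambda>t. f t + c * g t) (\<lambda>t. f t + c * g t)
         = cov f f + 2 * c * cov f g + c\<^sup>2 * cov g g"
proof -
  have cg: "continuous_on {0..1} (\<lambda>t. c * g t)"
    using g by (intro continuous_intros)
  have fg: "continuous_on {0..1} (\<lambda>t. f t + c * g t)"
    using f g by (intro continuous_intros)
  have 1: "cov h (\<lambda>t. f t + c * g t) = cov f h + c * cov g h"
    if "continuous_on {0..1} h" for h
    using cov_add_left[OF f cg that] cov_scale_left[OF g that]
    by (simp add: cov_commute[of h])
  show ?thesis
    using 1[OF fg] 1[OF f] 1[OF g]
    by (simp add: cov_commute[of g f] power2_eq_square algebra_simps)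
qed

lemma cov_Cauchy_Schwarz:
  assumes f: "continuous_on {0..1} f" and g: "continuous_on {0..1} g"
  shows "\<bar>cov f g\<bar> \<le> sqrt (cov f f) * sqrt (cov g g)"
proof -
  have q: "0 \<le> cov f f + 2 * c * cov f g + c\<^sup>2 * cov g g" for c
    using cov_self_nonneg[of "\<lambda>t. f t + c * g t"] cov_self_add_scale[OF f g, of c] f g
    by (simp add: continuous_intros)
  have "(cov f g)\<^sup>2 \<le> cov f f * cov g g"
  proof (cases "cov g g = 0")
    case True
    \<comment> \<open>The form is then affine in the scalar and bounded below, so its slope vanishes.\<close>
    have "cov f g = 0"
    proof (rule ccontr)
      assume "cov f g \<noteq> 0"
      then show False
        using q[of "- (cov f f + 1) / (2 * cov f g)"] True cov_self_nonneg[OF f]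
          by (simp add: field_simps)
    qed
    then show ?thesis using True by simp
  next
    case False
    then have pos: "cov g g > 0" using cov_self_nonneg[OF g] by simp
    then have "0 \<le> cov f f - (cov f g)\<^sup>2 / cov g g"
      using q[of "- cov f g / cov g g"] by (simp add: power2_eq_square field_simps)
    then show ?thesis using pos by (simp add: field_simps)
  qed
  then show ?thesis
    by (metis real_sqrt_abs real_sqrt_le_mono real_sqrt_mult)
qed

lemma sqrt_cov_triangle:
  assumes f: "continuous_on {0..1} f" and g: "continuous_on {0..1} g"
  shows "sqrt (cov (\<lambda>t. f t + g t) (\<lambda>t. f t + g t)) \<le> sqrt (cov f f) + sqrt (cov g g)"
proof (rule real_le_lsqrt)
  have "cov (\<lambda>t. f t + g t) (\<lambda>t. f t + g t) = cov f f + 2 * cov f g + cov g g"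
    using cov_self_add_scale[OF f g, of 1] by simp
  also have "\<dots> \<le> cov f f + 2 * (sqrt (cov f f) * sqrt (cov g g)) + cov g g"
    using cov_Cauchy_Schwarz[OF f g] by simp
  also have "\<dots> = (sqrt (cov f f) + sqrt (cov g g))\<^sup>2"
    using cov_self_nonneg[OF f] cov_self_nonneg[OF g] by (simp add: power2_sum)
  finally show "cov (\<lambda>t. f t + g t) (\<lambda>t. f t + g t) \<le> (sqrt (cov f f) + sqrt (cov g g))\<^sup>2" .
qed (use cov_self_nonneg[OF f] cov_self_nonneg[OF g] in auto)

lemma sqrt_cov_bounded:
  assumes f: "continuous_on {0..1} f" and B: "\<And>t. t \<in> {0..1} \<Longrightarrow> \<bar>f t\<bar> \<le> B"
  shows "sqrt (cov f f) \<le> B"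
proof (rule real_le_lsqrt)
  show "0 \<le> B" using B[of 0] by auto
  have "cov f f \<le> A (\<lambda>t. (f t - 0)\<^sup>2)" by (rule cov_self_le[OF f])
  also have "\<dots> \<le> A (\<lambda>_. B\<^sup>2)"
    using f B \<open>0 \<le> B\<close> by (intro mono continuous_intros) (auto simp: abs_le_square_iff[symmetric])
  finally show "cov f f \<le> B\<^sup>2" by (simp add: const)
qed

lemma mean_in_unit_interval: "A (\<lambda>t. t) \<in> {0..1}"
  using nonneg[of "\<lambda>t. t"] mono[of "\<lambda>t. t" "\<lambda>_. 1"] unital by auto

text \<open>
  The mean minimises the second moment, so the variance of \<open>f\<close> is at most its second moment about
  \<open>f m\<close>, where \<open>m\<close> is the mean of the identity; this is a single expectation to which the
  Lipschitz bound applies. The point \<open>m\<close> must lie in \<open>[0,1]\<close>, where \<open>f\<close> is Lipschitz.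
\<close>

lemma sqrt_cov_lipschitz:
  assumes f: "L-lipschitz_on {0..1} f"
  shows "sqrt (cov f f) \<le> L * sqrt (cov (\<lambda>t. t) (\<lambda>t. t))"
proof -
  define m where "m = A (\<lambda>t. t)"
  have m: "m \<in> {0..1}" using mean_in_unit_interval by (simp add: m_def)
  have L: "0 \<le> L" using f by (rule lipschitz_on_nonneg)
  have cont: "continuous_on {0..1} f" using f by (rule lipschitz_on_continuous_on)
  have "cov f f \<le> A (\<lambda>t. (f t - f m)\<^sup>2)" by (rule cov_self_le[OF cont])
  also have "\<dots> \<le> A (\<lambda>t. L\<^sup>2 * (t - m)\<^sup>2)"
  proof (rule mono)
    fix t :: real assume "t \<in> {0..1}"
    then have "\<bar>f t - f m\<bar> \<le> \<bar>L * (t - m)\<bar>"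
      using lipschitz_onD[OF f _ m] L by (simp add: dist_real_def abs_mult)
    then show "(f t - f m)\<^sup>2 \<le> L\<^sup>2 * (t - m)\<^sup>2"
      by (simp add: abs_le_square_iff power_mult_distrib)
  qed (use cont in \<open>auto intro!: continuous_intros\<close>)
  also have "\<dots> = L\<^sup>2 * cov (\<lambda>t. t) (\<lambda>t. t)"
    using second_moment_shift[of "\<lambda>t. t" m] by (subst scale) (auto simp: m_def intro!: continuous_intros)
  finally show ?thesis
    using L by (metis real_sqrt_le_mono real_sqrt_mult real_sqrt_unique)
qed

end

section \<open>Functions with an affine modulus of continuity\<close>

text \<open>
  The infimal convolution of \<open>f\<close> with \<open>L \<bar>\<cdot>\<bar>\<close> is \<open>L\<close>-Lipschitz and lies between \<open>f - a\<close> and \<open>f\<close>;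
  raising it by \<open>a/2\<close> centres it, which halves the error.
\<close>

lemma lipschitz_approximation:
  fixes f :: "real \<Rightarrow> real"
  assumes aff: "\<And>u v. \<lbrakk>u \<in> {0..1}; v \<in> {0..1}\<rbrakk> \<Longrightarrow> \<bar>f u - f v\<bar> \<le> a + L * \<bar>u - v\<bar>"
    and L: "0 \<le> L"
  obtains h where "L-lipschitz_on {0..1} h" "\<And>t. t \<in> {0..1} \<Longrightarrow> \<bar>f t - h t\<bar> \<le> a / 2"
proof
  define I where "I t = (INF u\<in>{0..1}. f u + L * \<bar>t - u\<bar>)" for t
  have lb: "f t - a \<le> f u + L * \<bar>t - u\<bar>" if "t \<in> {0..1}" "u \<in> {0..1}" for t u
    using aff[OF that] by linarith
  have low: "I t \<le> f u + L * \<bar>t - u\<bar>" if "t \<in> {0..1}" "u \<in> {0..1}" for t u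
    unfolding I_def using that lb by (intro cINF_lower bdd_belowI2) auto
  have great: "c \<le> I t" if "\<And>u. u \<in> {0..1} \<Longrightarrow> c \<le> f u + L * \<bar>t - u\<bar>" for c t
    unfolding I_def by (rule cINF_greatest) (use that in auto)
  have I_le: "I s \<le> I t + L * \<bar>s - t\<bar>" if "s \<in> {0..1}" "t \<in> {0..1}" for s t
  proof -
    have "I s - L * \<bar>s - t\<bar> \<le> I t"
    proof (rule great)
      fix u :: real assume "u \<in> {0..1}"
      moreover have "L * \<bar>s - u\<bar> \<le> L * \<bar>s - t\<bar> + L * \<bar>t - u\<bar>"
        unfolding distrib_left[symmetric] using L by (intro mult_left_mono) auto
      ultimately show "I s - L * \<bar>s - t\<bar> \<le> f u + L * \<bar>t - u\<bar>"
        using low[OF that(1), of u] by linarith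
    qed
    then show ?thesis by simp
  qed
  show "L-lipschitz_on {0..1} (\<lambda>t. I t + a / 2)"
  proof (rule lipschitz_onI)
    fix s t :: real assume "s \<in> {0..1}" "t \<in> {0..1}"
    then show "dist (I s + a / 2) (I t + a / 2) \<le> L * dist s t"
      using I_le[of s t] I_le[of t s] by (simp add: dist_real_def abs_minus_commute)
  qed (rule L)
  fix t :: real assume t: "t \<in> {0..1}"
  show "\<bar>f t - (I t + a / 2)\<bar> \<le> a / 2"
    using low[OF t t] great[OF lb[OF t]] by (simp add: abs_le_iff field_simps)
qed

lemma (in unital_positive_functional) sqrt_cov_affine_modulus:
  assumes f: "continuous_on {0..1} f"
    and aff: "\<And>u v. \<lbrakk>u \<in> {0..1}; v \<in> {0..1}\<rbrakk> \<Longrightarrow> \<bar>f u - f v\<bar> \<le> a + L * \<bar>u - v\<bar>"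
    and L: "0 \<le> L"
  shows "sqrt (cov f f) \<le> a / 2 + L * sqrt (cov (\<lambda>t. t) (\<lambda>t. t))"
proof -
  obtain h where h: "L-lipschitz_on {0..1} h" and fh: "\<And>t. t \<in> {0..1} \<Longrightarrow> \<bar>f t - h t\<bar> \<le> a / 2"
    using lipschitz_approximation[OF aff L] by blast
  have cont: "continuous_on {0..1} h" using h by (rule lipschitz_on_continuous_on)
  have d: "continuous_on {0..1} (\<lambda>t. f t - h t)" using f cont by (intro continuous_intros)
  have "sqrt (cov f f) \<le> sqrt (cov (\<lambda>t. f t - h t) (\<lambda>t. f t - h t)) + sqrt (cov h h)"
    using sqrt_cov_triangle[OF d cont] by simp
  also have "\<dots> \<le> a / 2 + L * sqrt (cov (\<lambda>t. t) (\<lambda>t. t))"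
    using sqrt_cov_bounded[OF d fh] sqrt_cov_lipschitz[OF h] by linarith
  finally show ?thesis .
qed

section \<open>Tangents of the least concave majorant\<close>

text \<open>
  At an interior point a concave function has a supporting line; its slope cannot be negative,
  because the line would then pass below the nonnegative function far to the right.
\<close>

lemma concave_tangent:
  fixes h :: "real \<Rightarrow> real"
  assumes conc: "concave_on {0..} h" and pos: "\<And>s. 0 \<le> s \<Longrightarrow> 0 \<le> h s" and t: "0 < t"
  obtains a L where "0 \<le> L" "a + L * t = h t" "\<And>s. 0 \<le> s \<Longrightarrow> h s \<le> a + L * s"
proof -
  define L where
    "L = - Inf ((\<lambda>s. ((- h t) - (- h s)) / (t - s)) ` ({t<..} \<inter> {0..}))"
  have L: "h s \<le> h t + L * (s - t)" if "0 \<le> s" for s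
    using convex_le_Inf_differential[of "{0..}" "\<lambda>s. - h s" t s] conc t that
    by (simp add: concave_on_def L_def)
  have "0 \<le> L"
  proof (rule ccontr)
    assume "\<not> 0 \<le> L"
    then have neg: "L < 0" by simp
    \<comment> \<open>The point at which the line takes the value \<open>-1\<close>.\<close>
    define s where "s = t + (h t + 1) / - L"
    have "0 \<le> (h t + 1) / - L" using neg pos[of t] t by (intro divide_nonneg_nonneg) auto
    then have "0 \<le> s" using t by (simp add: s_def)
    moreover have "h t + L * (s - t) = - 1" using neg by (simp add: s_def field_simps)
    ultimately show False using L[of s] pos[of s] by simp
  qed
  then show thesis
    using that[of L "h t - L * t"] L by (simp add: algebra_simps)
qed

lemma continuous_on_unit_interval_bounded:
  fixes f :: "real \<Rightarrow> real"
  assumes "continuous_on {0..1} f"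
  obtains B where "\<And>x. x \<in> {0..1} \<Longrightarrow> \<bar>f x\<bar> \<le> B"
  using compact_continuous_image[OF assms]
  by (metis compact_Icc compact_imp_bounded bounded_iff imageI real_norm_def)

lemma abs_diff_le_modulus:
  assumes f: "continuous_on {0..1} f" and "u \<in> {0..1}" "v \<in> {0..1}" "\<bar>u - v\<bar> \<le> t"
  shows "\<bar>f u - f v\<bar> \<le> modulus f t"
  unfolding modulus_def
proof (rule cSup_upper)
  obtain B where B: "\<And>x. x \<in> {0..1} \<Longrightarrow> \<bar>f x\<bar> \<le> B"
    using continuous_on_unit_interval_bounded[OF f] by blast
  show "bdd_above {\<bar>f u' - f v'\<bar> | u' v'. u' \<in> {0..1} \<and> v' \<in> {0..1} \<and> \<bar>u' - v'\<bar> \<le> t}"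
  proof (rule bdd_aboveI[of _ "2 * B"], clarify)
    fix u' v' :: real assume "u' \<in> {0..1}" "v' \<in> {0..1}"
    then show "\<bar>f u' - f v'\<bar> \<le> 2 * B" using B[of u'] B[of v'] by linarith
  qed
qed (use assms in blast)

lemma modulus_tilde_nonneg:
  assumes "continuous_on {0..1} f" "0 \<le> t"
  shows "0 \<le> modulus_tilde f t"
proof (rule modulus_tilde_greatest[OF assms(1)])
  fix h assume "concave_majorant (modulus f) h"
  then show "0 \<le> h t"
    using abs_diff_le_modulus[OF assms(1), of 0 0 t] assms(2)
    by (force simp: concave_majorant_def)
qed

text \<open>
  Near the diagonal the offset \<open>\<epsilon>\<close> suffices by uniform continuity; away from it a steep enough
  slope dominates the oscillation of the bounded function \<open>f\<close>.
\<close>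

lemma affine_modulus_small_offset:
  fixes f :: "real \<Rightarrow> real"
  assumes f: "continuous_on {0..1} f" and "0 < \<epsilon>"
  obtains L where "0 \<le> L"
    "\<And>u v. \<lbrakk>u \<in> {0..1}; v \<in> {0..1}\<rbrakk> \<Longrightarrow> \<bar>f u - f v\<bar> \<le> \<epsilon> + L * \<bar>u - v\<bar>"
proof -
  obtain B where B: "\<And>x. x \<in> {0..1} \<Longrightarrow> \<bar>f x\<bar> \<le> B"
    using continuous_on_unit_interval_bounded[OF f] by blast
  have B0: "0 \<le> B" using B[of 0] by auto
  have "uniformly_continuous_on {0..1} f"
    using f by (simp add: compact_uniformly_continuous)
  then obtain \<delta> where "0 < \<delta>"
    and \<delta>: "\<And>u v. \<lbrakk>u \<in> {0..1}; v \<in> {0..1}; \<bar>u - v\<bar> < \<delta>\<rbrakk> \<Longrightarrow> \<bar>f u - f v\<bar> < \<epsilon>"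
    unfolding uniformly_continuous_on_def dist_real_def using \<open>0 < \<epsilon>\<close> by metis
  show thesis
  proof (rule that[of "2 * B / \<delta>"])
    show "0 \<le> 2 * B / \<delta>" using B0 \<open>0 < \<delta>\<close> by simp
    fix u v :: real assume uv: "u \<in> {0..1}" "v \<in> {0..1}"
    show "\<bar>f u - f v\<bar> \<le> \<epsilon> + 2 * B / \<delta> * \<bar>u - v\<bar>"
    proof (cases "\<bar>u - v\<bar> < \<delta>")
      case True
      have "0 \<le> 2 * B / \<delta> * \<bar>u - v\<bar>" using B0 \<open>0 < \<delta>\<close> by simp
      then show ?thesis using \<delta>[OF uv True] by linarith
    next
      case False
      have "\<bar>f u - f v\<bar> \<le> 2 * B / \<delta> * \<delta>" using B[OF uv(1)] B[OF uv(2)] \<open>0 < \<delta>\<close> by simp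
      also have "\<dots> \<le> 2 * B / \<delta> * \<bar>u - v\<bar>"
        using False B0 \<open>0 < \<delta>\<close> by (intro mult_left_mono) auto
      finally show ?thesis using \<open>0 < \<epsilon>\<close> by linarith
    qed
  qed
qed

text \<open>
  Half the tangent at \<open>2\<sigma>\<close>, evaluated at \<open>2\<sigma>\<close>, is exactly the bound \<open>a/2 + L \<sigma>\<close> of
  \<open>sqrt_cov_affine_modulus\<close>; hence the factor \<open>2\<close> in front of the standard deviation.
\<close>

lemma (in unital_positive_functional) sqrt_cov_le_modulus_tilde:
  assumes f: "continuous_on {0..1} f"
  shows "sqrt (cov f f) \<le> modulus_tilde f (2 * sqrt (cov (\<lambda>t. t) (\<lambda>t. t))) / 2"
proof (cases "cov (\<lambda>t. t) (\<lambda>t. t) = 0")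
  case True
  have "sqrt (cov f f) \<le> 0 + \<epsilon>" if \<epsilon>: "0 < \<epsilon>" for \<epsilon>
  proof -
    obtain L where "0 \<le> L"
      "\<And>u v. \<lbrakk>u \<in> {0..1}; v \<in> {0..1}\<rbrakk> \<Longrightarrow> \<bar>f u - f v\<bar> \<le> 2 * \<epsilon> + L * \<bar>u - v\<bar>"
      using affine_modulus_small_offset[OF f, of "2 * \<epsilon>"] \<epsilon> by auto
    then show ?thesis using sqrt_cov_affine_modulus[OF f, of "2 * \<epsilon>" L] True by simp
  qed
  then have "sqrt (cov f f) \<le> 0" by (rule field_le_epsilon)
  also have "0 \<le> modulus_tilde f (2 * sqrt (cov (\<lambda>t. t) (\<lambda>t. t))) / 2"
    using modulus_tilde_nonneg[OF f, of 0] True by simp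
  finally show ?thesis .
next
  case False
  define \<sigma> where "\<sigma> = sqrt (cov (\<lambda>t. t) (\<lambda>t. t))"
  have "0 < \<sigma>" using False cov_self_nonneg[of "\<lambda>t. t"] by (simp add: \<sigma>_def)
  have maj: "concave_majorant (modulus f) (modulus_tilde f)"
    by (rule modulus_tilde_concave_majorant[OF f])
  obtain a L where L: "0 \<le> L" and at: "a + L * (2 * \<sigma>) = modulus_tilde f (2 * \<sigma>)"
    and aL: "\<And>s. 0 \<le> s \<Longrightarrow> modulus_tilde f s \<le> a + L * s"
    using concave_tangent[of "modulus_tilde f" "2 * \<sigma>"] maj modulus_tilde_nonneg[OF f] \<open>0 < \<sigma>\<close>
    unfolding concave_majorant_def by (metis mult_pos_pos zero_less_numeral)
  have "\<bar>f u - f v\<bar> \<le> a + L * \<bar>u - v\<bar>" if "u \<in> {0..1}" "v \<in> {0..1}" for u v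
  proof -
    have "\<bar>f u - f v\<bar> \<le> modulus f \<bar>u - v\<bar>" by (rule abs_diff_le_modulus[OF f that order_refl])
    also have "\<dots> \<le> modulus_tilde f \<bar>u - v\<bar>" using maj by (simp add: concave_majorant_def)
    also have "\<dots> \<le> a + L * \<bar>u - v\<bar>" by (rule aL) simp
    finally show ?thesis .
  qed
  then have "sqrt (cov f f) \<le> a / 2 + L * \<sigma>"
    unfolding \<sigma>_def using L by (rule sqrt_cov_affine_modulus[OF f])
  also have "\<dots> = modulus_tilde f (2 * \<sigma>) / 2" using at by simp
  finally show ?thesis by (simp add: \<sigma>_def)
qed

section \<open>Bernstein-Euler-Jacobi operators\<close>

lemma unital_positive_point:
  assumes "y \<in> {0..1}"
  shows "unital_positive_functional (\<lambda>f. f y)"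
  using assms by unfold_locales auto

lemma unital_positive_convex_combination:
  assumes A: "\<And>k. k \<in> K \<Longrightarrow> unital_positive_functional (A k)"
    and w: "\<And>k. k \<in> K \<Longrightarrow> 0 \<le> w k" "sum w K = 1"
  shows "unital_positive_functional (\<lambda>f. \<Sum>k\<in>K. A k f * w k)"
proof
  fix f g assume fg: "continuous_on {0..1} (f :: real \<Rightarrow> real)" "continuous_on {0..1} (g :: real \<Rightarrow> real)"
  have "A k (\<lambda>t. f t + g t) * w k = A k f * w k + A k g * w k" if "k \<in> K" for k
    using unital_positive_functional.add[OF A[OF that] fg] by (simp add: distrib_right)
  then show "(\<Sum>k\<in>K. A k (\<lambda>t. f t + g t) * w k) = (\<Sum>k\<in>K. A k f * w k) + (\<Sum>k\<in>K. A k g * w k)"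
    by (simp add: sum.distrib[symmetric])
next
  fix f c assume f: "continuous_on {0..1} (f :: real \<Rightarrow> real)"
  have "(\<Sum>k\<in>K. A k (\<lambda>t. c * f t) * w k) = (\<Sum>k\<in>K. c * (A k f * w k))"
  proof (rule sum.cong[OF refl])
    fix k assume "k \<in> K"
    then show "A k (\<lambda>t. c * f t) * w k = c * (A k f * w k)"
      using unital_positive_functional.scale[OF A f] by simp
  qed
  then show "(\<Sum>k\<in>K. A k (\<lambda>t. c * f t) * w k) = c * (\<Sum>k\<in>K. A k f * w k)"
    by (simp only: sum_distrib_left)
next
  fix f assume f: "continuous_on {0..1} (f :: real \<Rightarrow> real)" "\<And>t. t \<in> {0..1} \<Longrightarrow> 0 \<le> f t"
  show "0 \<le> (\<Sum>k\<in>K. A k f * w k)"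
  proof (rule sum_nonneg)
    fix k assume k: "k \<in> K"
    show "0 \<le> A k f * w k"
      by (rule mult_nonneg_nonneg[OF unital_positive_functional.nonneg[OF A[OF k] f] w(1)[OF k]])
  qed
next
  show "(\<Sum>k\<in>K. A k (\<lambda>_. 1) * w k) = 1"
    using w(2) A by (simp add: unital_positive_functional.unital)
qed

lemma unital_positive_compose:
  assumes A: "unital_positive_functional A"
    and H: "\<And>y. y \<in> {0..1} \<Longrightarrow> unital_positive_functional (\<lambda>f. H f y)"
    and cont: "\<And>f. continuous_on {0..1} f \<Longrightarrow> continuous_on {0..1} (H f)"
  shows "unital_positive_functional (\<lambda>f. A (H f))"
proof -
  interpret A: unital_positive_functional A by (rule A)
  show ?thesis
  proof
    fix f g assume fg: "continuous_on {0..1} (f :: real \<Rightarrow> real)" "continuous_on {0..1} (g :: real \<Rightarrow> real)"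
    have "A (H (\<lambda>t. f t + g t)) = A (\<lambda>y. H f y + H g y)"
      using fg by (intro A.cong cont continuous_intros unital_positive_functional.add[OF H])
    also have "\<dots> = A (H f) + A (H g)" using fg by (intro A.add cont)
    finally show "A (H (\<lambda>t. f t + g t)) = A (H f) + A (H g)" .
  next
    fix f c assume f: "continuous_on {0..1} (f :: real \<Rightarrow> real)"
    have "A (H (\<lambda>t. c * f t)) = A (\<lambda>y. c * H f y)"
      using f by (intro A.cong cont continuous_intros unital_positive_functional.scale[OF H])
    also have "\<dots> = c * A (H f)" using f by (intro A.scale cont)
    finally show "A (H (\<lambda>t. c * f t)) = c * A (H f)" .
  next
    fix f assume f: "continuous_on {0..1} (f :: real \<Rightarrow> real)" "\<And>t. t \<in> {0..1} \<Longrightarrow> 0 \<le> f t"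
    show "0 \<le> A (H f)"
      by (rule A.nonneg[OF cont[OF f(1)]]) (rule unital_positive_functional.nonneg[OF H f])
  next
    have "A (H (\<lambda>_. 1)) = A (\<lambda>_. 1)"
      by (intro A.cong cont continuous_intros unital_positive_functional.unital[OF H])
    then show "A (H (\<lambda>_. 1)) = 1" by (simp add: A.unital)
  qed
qed

text \<open>
  Away from the two exceptional endpoint cases both exponents of the weight exceed \<open>-1\<close>, so the
  weight is integrable with total mass a Beta function value, and the operator is an average
  against a probability density. In the exceptional cases it is point evaluation at \<open>x\<close>.
\<close>

lemma unital_positive_beta_op:
  assumes r: "0 < r" and a: "- 1 \<le> a" and b: "- 1 \<le> b" and x: "x \<in> {0..1}"
  shows "unital_positive_functional (\<lambda>f. beta_op r a b f x)"
proof (cases "a = - 1 \<and> x = 0 \<or> b = - 1 \<and> x = 1")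
  case True
  then have "(\<lambda>f. beta_op r a b f x) = (\<lambda>f. f x)" by (auto simp: beta_op_def fun_eq_iff)
  then show ?thesis using unital_positive_point[OF x] by simp
next
  case False
  define p q where "p = r * x + a + 1" and "q = r * (1 - x) + b + 1"
  have p: "0 < p"
  proof (cases "x = 0")
    case False
    then have "0 < r * x" using r x by simp
    then show ?thesis using a by (simp add: p_def)
  qed (use a False in \<open>auto simp: p_def\<close>)
  have q: "0 < q"
  proof (cases "x = 1")
    case False
    then have "0 < r * (1 - x)" using r x by simp
    then show ?thesis using b by (simp add: q_def)
  qed (use b False in \<open>auto simp: q_def\<close>)
  let ?w = "beta_weight r a b x"
  have w: "(?w has_integral Beta p q) {0..1}"
    using has_integral_Beta_real[OF p q] by (simp add: p_def q_def beta_weight_def[abs_def])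
  have w_nonneg: "0 \<le> ?w t" for t by (simp add: beta_weight_def)
  have pos: "0 < Beta p q"
    using p q by (simp add: Beta_def Gamma_real_pos)
  have int: "integral {0..1} ?w = Beta p q" using w by (rule integral_unique)
  have op: "beta_op r a b f x = integral {0..1} (\<lambda>t. ?w t * f t) / Beta p q" for f
    using False by (auto simp: beta_op_def int)
  have wf: "(\<lambda>t. ?w t * f t) integrable_on {0..1}" if f: "continuous_on {0..1} f" for f
  proof -
    have "?w absolutely_integrable_on {0..1}"
      using w w_nonneg by (intro nonnegative_absolutely_integrable_1) (auto simp: integrable_on_def)
    moreover have "bounded (f ` {0..1})"
      using f by (intro compact_imp_bounded compact_continuous_image) auto
    ultimately have "(\<lambda>t. f t * ?w t) absolutely_integrable_on {0..1}"
      using f by (intro absolutely_integrable_bounded_measurable_product_real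
          continuous_imp_measurable_on_sets_lebesgue) auto
    then show ?thesis by (simp add: mult.commute absolutely_integrable_on_def)
  qed
  show ?thesis
  proof
    fix f g assume fg: "continuous_on {0..1} (f :: real \<Rightarrow> real)" "continuous_on {0..1} (g :: real \<Rightarrow> real)"
    show "beta_op r a b (\<lambda>t. f t + g t) x = beta_op r a b f x + beta_op r a b g x"
      using integral_add[OF wf[OF fg(1)] wf[OF fg(2)]]
      by (simp add: op distrib_left add_divide_distrib)
  next
    fix f c
    show "beta_op r a b (\<lambda>t. c * f t) x = c * beta_op r a b f x"
      by (simp add: op mult.left_commute[of _ c])
  next
    fix f assume "continuous_on {0..1} (f :: real \<Rightarrow> real)" "\<And>t. t \<in> {0..1} \<Longrightarrow> 0 \<le> f t"
    then show "0 \<le> beta_op r a b f x"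
      unfolding op using pos w_nonneg by (intro divide_nonneg_pos integral_nonneg wf) auto
  next
    show "beta_op r a b (\<lambda>_. 1) x = 1" using pos by (simp add: op int)
  qed
qed

text \<open>
  A Bernstein operator samples its argument at finitely many points, so the composite is a convex
  combination of the functionals \<open>f \<mapsto> H f (k/n)\<close>. This is how a Beta operator enters when it is
  followed by a Bernstein operator: pointwise, whereas \<open>unital_positive_compose\<close> would ask for its
  output to be continuous up to the endpoints.
\<close>

lemma unital_positive_bernstein_op_comp:
  assumes "0 < n" and y: "y \<in> {0..1}"
    and H: "\<And>z. z \<in> {0..1} \<Longrightarrow> unital_positive_functional (\<lambda>f. H f z)"
  shows "unital_positive_functional (\<lambda>f. bernstein_op n (H f) y)"
  unfolding bernstein_op_def
  using assms by (intro unital_positive_convex_combination H) (auto intro!: Bernstein_nonneg)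

lemma continuous_on_bernstein_op: "continuous_on S (bernstein_op n f)"
  unfolding bernstein_op_def[abs_def] Bernstein_def by (intro continuous_intros)

lemma unital_positive_bernstein_op:
  assumes "0 < n" "y \<in> {0..1}"
  shows "unital_positive_functional (\<lambda>f. bernstein_op n f y)"
  using unital_positive_bernstein_op_comp[OF assms, of "\<lambda>f. f"] unital_positive_point by simp

lemma unital_positive_BEJ_I:
  assumes "0 < r" "- 1 \<le> a" "- 1 \<le> b" "0 < m" "0 < n" "x \<in> {0..1}"
  shows "unital_positive_functional (\<lambda>f. BEJ_I r a b m n f x)"
  unfolding BEJ_I_def o_def
proof (rule unital_positive_bernstein_op_comp)
  fix z :: real assume "z \<in> {0..1}"
  with assms show "unital_positive_functional (\<lambda>f. beta_op r a b (bernstein_op n f) z)"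
    by (intro unital_positive_compose[OF unital_positive_beta_op] unital_positive_bernstein_op
        continuous_on_bernstein_op)
qed (use assms in auto)

lemma unital_positive_BEJ_II:
  assumes "0 < s" "- 1 \<le> c" "- 1 \<le> d" "0 < r" "- 1 \<le> a" "- 1 \<le> b" "0 < n" "x \<in> {0..1}"
  shows "unital_positive_functional (\<lambda>f. BEJ_II s c d r a b n f x)"
  unfolding BEJ_II_def o_def
  using assms
  by (intro unital_positive_compose[OF unital_positive_beta_op] unital_positive_bernstein_op_comp
      unital_positive_beta_op continuous_on_bernstein_op)

theorem mainTheorem3:
  fixes R :: "(real \<Rightarrow> real) \<Rightarrow> real \<Rightarrow> real"
    and f g :: "real \<Rightarrow> real"
    and x :: real
  assumes "is_BEJ_I R \<or> is_BEJ_II R"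
    and "\<exists>y\<in>{0..1}. R (e 1) y \<noteq> e 1 y"
    and "continuous_on {0..1} f"
    and "continuous_on {0..1} g"
    and "x \<in> {0..1}"
  shows "\<bar>chebyshev_functional R f g x\<bar>
           \<le> 1 / 4 * modulus_tilde f (2 * sqrt (chebyshev_functional R (e 1) (e 1) x))
                 * modulus_tilde g (2 * sqrt (chebyshev_functional R (e 1) (e 1) x))
       \<and> chebyshev_functional R (e 1) (e 1) x
           = R (\<lambda>t. (e 1 t - x * e 0 t)\<^sup>2) x - (R (\<lambda>t. e 1 t - x * e 0 t) x)\<^sup>2"
proof -
  interpret unital_positive_functional "\<lambda>f. R f x"
    using assms(1,5) unital_positive_BEJ_I unital_positive_BEJ_II
    by (auto simp: is_BEJ_I_def is_BEJ_II_def)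
  have cov: "chebyshev_functional R h k x = cov h k" for h k
    by (simp add: chebyshev_functional_def cov_def)
  have e1: "e 1 = (\<lambda>t. t)" by (simp add: e_def)
  define \<sigma> where "\<sigma> = sqrt (cov (\<lambda>t. t) (\<lambda>t. t))"
  have "\<bar>cov f g\<bar> \<le> sqrt (cov f f) * sqrt (cov g g)"
    by (rule cov_Cauchy_Schwarz[OF assms(3,4)])
  also have "\<dots> \<le> (modulus_tilde f (2 * \<sigma>) / 2) * (modulus_tilde g (2 * \<sigma>) / 2)"
    unfolding \<sigma>_def using assms(3,4) cov_self_nonneg
    by (intro mult_mono sqrt_cov_le_modulus_tilde) (auto intro!: modulus_tilde_nonneg)
  finally have bound: "\<bar>cov f g\<bar> \<le> 1 / 4 * modulus_tilde f (2 * \<sigma>) * modulus_tilde g (2 * \<sigma>)"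
    by simp
  have "R (\<lambda>t. t - x) x = R (\<lambda>t. t) x - x"
    using diff[of "\<lambda>t. t" "\<lambda>_. x"] const by simp
  then have "cov (\<lambda>t. t) (\<lambda>t. t) = R (\<lambda>t. (t - x)\<^sup>2) x - (R (\<lambda>t. t - x) x)\<^sup>2"
    using second_moment_shift[of "\<lambda>t. t" x] by simp
  then show ?thesis using bound unfolding cov e1 \<sigma>_def by (simp add: e_def)
qed

end
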